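(* Let $d,c:(X_1,P_1)\to(X_0,P_0)$ and $e:(X_0,P_0)\to(X_1,P_1)$ be a reflexive graph in $\mathbf{RPOGrp}$ (i.e. $de=ce=\mathrm{id}$). Then there exists at most one morphism $$m:(X_1\times_{X_0}X_1,\;P_1\times_{P_0}P_1)\to(X_1,P_1)$$ in $\mathbf{RPOGrp}$ such that $(d,c,e,m)$ is an internal category in $\mathbf{RPOGrp}$.
   Context: A right-preordered group is a pair $(G,P_G)$ with $G$ a group (not necessarily abelian) and $P_G$ a submonoid of $G$ (the positive cone). Morphisms $(G,P_G)\to(H,P_H)$ in $\mathbf{RPOGrp}$ are group homomorphisms $f$ with $f(P_G)\subseteq P_H$. Limits are computed separately on groups and on positive cones. The object of composable pairs is the pullback $X_1\times_{X_0}X_1=\{(a,b)\mid d(a)=c(b)\}$ with positive cone $P_1\times_{P_0}P_1$ (those pairs with $a,b\in P_1$). An internal category structure on the reflexive graph is a morphism $m$ (composition, $m(a,b)$ being "$a$ after $b$") such that $d(m(a,b))=d(b)$, $c(m(a,b))=c(a)$, $m(e(c(b)),b)=b$, $m(a,e(d(a)))=a$, and $m$ is associative. *)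

theory Defs
  imports "HOL-Algebra.Group" "HOL-Library.FuncSet"
begin

text \<open>Groups are written multiplicatively and are not assumed abelian.\<close>

record 'a rpo_grp = "'a monoid" +
  cone :: "'a set"

locale rpo_group = group G + submonoid "cone G" G for G :: "'a rpo_grp" (structure)

text \<open>
  Extensionality (the value is \<^const>\<open>undefined\<close> outside the carrier) makes HOL equality of the
  representing functions coincide with equality of morphisms.
\<close>

definition rpo_hom :: "'a rpo_grp \<Rightarrow> 'b rpo_grp \<Rightarrow> ('a \<Rightarrow> 'b) set" where
  "rpo_hom G H = {f \<in> hom G H. f \<in> extensional (carrier G) \<and> f ` cone G \<subseteq> cone H}"

definition rpo_pullback ::
  "'a rpo_grp \<Rightarrow> 'b rpo_grp \<Rightarrow> ('a \<Rightarrow> 'c) \<Rightarrow> ('b \<Rightarrow> 'c) \<Rightarrow> ('a \<times> 'b) rpo_grp" where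
  "rpo_pullback A B f g =
     \<lparr>carrier = {(a, b). a \<in> carrier A \<and> b \<in> carrier B \<and> f a = g b},
      mult = (\<lambda>(a, b) (a', b'). (a \<otimes>\<^bsub>A\<^esub> a', b \<otimes>\<^bsub>B\<^esub> b')),
      one = (\<one>\<^bsub>A\<^esub>, \<one>\<^bsub>B\<^esub>),
      cone = {(a, b). a \<in> cone A \<and> b \<in> cone B \<and> f a = g b}\<rparr>"

lemma rpo_group_pullback:
  assumes "rpo_group A" "rpo_group B" "rpo_group C"
    and f: "f \<in> rpo_hom A C" and g: "g \<in> rpo_hom B C"
  shows "rpo_group (rpo_pullback A B f g)"
proof -
  interpret A: rpo_group A by fact
  interpret B: rpo_group B by fact
  interpret C: rpo_group C by fact
  interpret f: group_hom A C f
    using f by unfold_locales (auto simp: rpo_hom_def)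
  interpret g: group_hom B C g
    using g by unfold_locales (auto simp: rpo_hom_def)
  have "group (rpo_pullback A B f g)"
  proof (rule groupI)
    fix x assume x: "x \<in> carrier (rpo_pullback A B f g)"
    obtain a b where ab: "x = (a, b)" by (cases x)
    show "\<exists>y\<in>carrier (rpo_pullback A B f g). y \<otimes>\<^bsub>rpo_pullback A B f g\<^esub> x = \<one>\<^bsub>rpo_pullback A B f g\<^esub>"
      using x by (intro bexI[of _ "(inv\<^bsub>A\<^esub> a, inv\<^bsub>B\<^esub> b)"]) (auto simp: rpo_pullback_def ab)
  qed (auto simp: rpo_pullback_def A.m_assoc B.m_assoc)
  moreover have "submonoid (cone (rpo_pullback A B f g)) (rpo_pullback A B f g)"
    by unfold_locales (auto simp: rpo_pullback_def)
  ultimately show ?thesis by (rule rpo_group.intro)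
qed

locale rpo_reflexive_graph =
  X1: rpo_group X1 + X0: rpo_group X0
  for X1 :: "'a rpo_grp" and X0 :: "'b rpo_grp" +
  fixes d c :: "'a \<Rightarrow> 'b" and e :: "'b \<Rightarrow> 'a"
  assumes d_hom: "d \<in> rpo_hom X1 X0"
    and c_hom: "c \<in> rpo_hom X1 X0"
    and e_hom: "e \<in> rpo_hom X0 X1"
    and d_e: "x \<in> carrier X0 \<Longrightarrow> d (e x) = x"
    and c_e: "x \<in> carrier X0 \<Longrightarrow> c (e x) = x"

abbreviation composable_pairs ::
  "'a rpo_grp \<Rightarrow> ('a \<Rightarrow> 'b) \<Rightarrow> ('a \<Rightarrow> 'b) \<Rightarrow> ('a \<times> 'a) rpo_grp" where
  "composable_pairs X1 d c \<equiv> rpo_pullback X1 X1 d c"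

locale rpo_internal_category = rpo_reflexive_graph X1 X0 d c e
  for X1 :: "'a rpo_grp" and X0 :: "'b rpo_grp"
    and d c :: "'a \<Rightarrow> 'b" and e :: "'b \<Rightarrow> 'a" +
  fixes m :: "'a \<times> 'a \<Rightarrow> 'a"
  assumes m_hom: "m \<in> rpo_hom (composable_pairs X1 d c) X1"
    and dom_comp: "(a, b) \<in> carrier (composable_pairs X1 d c) \<Longrightarrow> d (m (a, b)) = d b"
    and cod_comp: "(a, b) \<in> carrier (composable_pairs X1 d c) \<Longrightarrow> c (m (a, b)) = c a"
    and left_unit: "b \<in> carrier X1 \<Longrightarrow> m (e (c b), b) = b"
    and right_unit: "a \<in> carrier X1 \<Longrightarrow> m (a, e (d a)) = a"
    and assoc: "\<lbrakk>(f, g) \<in> carrier (composable_pairs X1 d c); (g, h) \<in> carrier (composable_pairs X1 d c)\<rbrakk>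
      \<Longrightarrow> m (f, m (g, h)) = m (m (f, g), h)"

end

(* Each composable pair factors as (a, b) = (a e(d a)^-1, 1) * (e(c b), b). A homomorphic m takes the
   values a e(d a)^-1 and b on the two factors by the unit laws, so m(a, b) = a e(d a)^-1 b. *)
theory Submission
  imports Defs
begin

text \<open>Every composable pair is a product of a pair \<open>(k, 1)\<close> with \<open>k\<close>
  in the kernel of \<open>d\<close> and a pair \<open>(e (c b), b)\<close>. The unit laws fix
  \<open>m\<close> on both kinds of pair, so multiplicativity leaves one possible value, the formula
  in \<open>comp_eq\<close>, which mentions only the reflexive graph.\<close>

lemma (in rpo_internal_category) comp_eq:
  assumes ab: "(a, b) \<in> carrier (composable_pairs X1 d c)"
  shows "m (a, b) = a \<otimes>\<^bsub>X1\<^esub> inv\<^bsub>X1\<^esub> (e (d a)) \<otimes>\<^bsub>X1\<^esub> b"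
proof -
  interpret d: group_hom X1 X0 d
    using d_hom by unfold_locales (auto simp: rpo_hom_def)
  interpret c: group_hom X1 X0 c
    using c_hom by unfold_locales (auto simp: rpo_hom_def)
  interpret e: group_hom X0 X1 e
    using e_hom by unfold_locales (auto simp: rpo_hom_def)
  let ?P = "composable_pairs X1 d c"
  \<comment> \<open>Dividing \<open>a\<close> by the identity arrow at its domain moves it into the
    kernel of \<open>d\<close>, because \<open>d (e (d a)) = d a\<close>.\<close>
  let ?k = "a \<otimes>\<^bsub>X1\<^esub> inv\<^bsub>X1\<^esub> (e (d a))"
  have a: "a \<in> carrier X1" and b: "b \<in> carrier X1" and dc: "d a = c b"
    using ab by (auto simp: rpo_pullback_def)
  have k: "?k \<in> carrier X1" "d ?k = \<one>\<^bsub>X0\<^esub>"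
    using a by (auto simp: d_e)
  \<comment> \<open>The first coordinates multiply to \<open>a\<close> because
    \<open>d a = c b\<close> makes \<open>e (c b)\<close> cancel the inverse in
    \<open>?k\<close>.\<close>
  have "(a, b) = (?k, \<one>\<^bsub>X1\<^esub>) \<otimes>\<^bsub>?P\<^esub> (e (c b), b)"
    using a b by (simp add: rpo_pullback_def X1.m_assoc flip: dc)
  moreover have "(?k, \<one>\<^bsub>X1\<^esub>) \<in> carrier ?P" "(e (c b), b) \<in> carrier ?P"
    using k b by (auto simp: rpo_pullback_def d_e)
  moreover have "m \<in> hom ?P X1"
    using m_hom by (simp add: rpo_hom_def)
  ultimately have "m (a, b) = m (?k, \<one>\<^bsub>X1\<^esub>) \<otimes>\<^bsub>X1\<^esub> m (e (c b), b)"
    by (metis hom_mult)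
  \<comment> \<open>Here \<open>d ?k = 1\<close> gives \<open>e (d ?k) = 1\<close>, so the second
    entry is the identity arrow that the right unit law requires.\<close>
  moreover have "m (?k, \<one>\<^bsub>X1\<^esub>) = ?k"
    using right_unit[OF k(1)] k(2) by simp
  ultimately show ?thesis
    using left_unit[OF b] by simp
qed

theorem mainTheorem7:
  fixes X1 :: "'a rpo_grp" and X0 :: "'b rpo_grp"
    and d c :: "'a \<Rightarrow> 'b" and e :: "'b \<Rightarrow> 'a"
  assumes "rpo_reflexive_graph X1 X0 d c e"
  shows "\<exists>\<^sub>\<le>\<^sub>1 m. m \<in> rpo_hom (composable_pairs X1 d c) X1
    \<and> rpo_internal_category X1 X0 d c e m"
proof (intro Uniq_I, elim conjE)
  fix m m'
  let ?P = "composable_pairs X1 d c"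
  assume hom: "m \<in> rpo_hom ?P X1" "m' \<in> rpo_hom ?P X1"
    and cat: "rpo_internal_category X1 X0 d c e m" "rpo_internal_category X1 X0 d c e m'"
  show "m = m'"
  \<comment> \<open>Off the carrier both maps are \<open>undefined\<close>, so agreement on
    composable pairs suffices.\<close>
  proof (rule extensionalityI)
    show "m \<in> extensional (carrier ?P)" "m' \<in> extensional (carrier ?P)"
      using hom by (simp_all add: rpo_hom_def)
  next
    fix x assume "x \<in> carrier ?P"
    then show "m x = m' x"
      using cat[THEN rpo_internal_category.comp_eq] by (cases x) simp
  qed
qed

end
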